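(* Let $1<d_1<d_2<d_3$ be integers with $\gcd(d_1,d_2)=1$ such that $\{d_1,d_2,d_3\}$ is a minimal generating set of the semigroup $S(d_1,d_2,d_3)$. Let $a_{33}=\min\{v\ge2: vd_3=v_1d_1+v_2d_2,\ v_1,v_2\in\mathbb Z_{\ge0}\}$. For $1\le k<a_{33}$, write $kd_3=d_1d_2-p_{kd_3}d_1-q_{kd_3}d_2$ with integers $p_{kd_3},q_{kd_3}\ge1$, and set $$\Omega^k=\{u_1d_1+u_2d_2+kd_3:\ 0\le u_1\le p_{kd_3}-1,\ 0\le u_2\le q_{kd_3}-1\}.$$ If $\bar\sigma\in\Delta(d_1,d_2)$ is representable as a nonnegative integer combination of $d_1,d_2,d_3$, then $\bar\sigma\in\Omega^k$ for at least one $k$ with $1\le k<a_{33}$.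
   Context: $S(d_1,d_2,d_3)$ is the set of nonnegative integer combinations of $d_1,d_2,d_3$; minimal means no $d_i$ is a nonnegative integer combination of the other two. $\Delta(d_1,d_2)$ is the set of positive integers not representable as nonnegative integer combinations of $d_1,d_2$. For $\gcd(d_1,d_2)=1$, every $t\in\Delta(d_1,d_2)$ has a unique representation $t=d_1d_2-pd_1-qd_2$ with $1\le p\le\lfloor d_2-d_2/d_1\rfloor$, $1\le q\le d_1-1$; and $kd_3\in\Delta(d_1,d_2)$ for $1\le k<a_{33}$, so $p_{kd_3},q_{kd_3}$ are well defined. *)

theory Defs
  imports Main
begin

definition semigroup2 :: "nat \<Rightarrow> nat \<Rightarrow> nat set" where
  "semigroup2 d1 d2 = {u1 * d1 + u2 * d2 | u1 u2. True}"

definition semigroup3 :: "nat \<Rightarrow> nat \<Rightarrow> nat \<Rightarrow> nat set" where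
  "semigroup3 d1 d2 d3 = {u1 * d1 + u2 * d2 + u3 * d3 | u1 u2 u3. True}"

definition minimal_generators :: "nat \<Rightarrow> nat \<Rightarrow> nat \<Rightarrow> bool" where
  "minimal_generators d1 d2 d3 \<longleftrightarrow>
     d1 \<notin> semigroup2 d2 d3 \<and> d2 \<notin> semigroup2 d1 d3 \<and> d3 \<notin> semigroup2 d1 d2"

definition gaps :: "nat \<Rightarrow> nat \<Rightarrow> nat set" where
  "gaps d1 d2 = {t. 0 < t \<and> t \<notin> semigroup2 d1 d2}"

text \<open>The minimum exists whenever \<open>d1 \<ge> 2\<close>, since \<open>v = d1\<close> qualifies.\<close>

definition a33 :: "nat \<Rightarrow> nat \<Rightarrow> nat \<Rightarrow> nat" where
  "a33 d1 d2 d3 = (LEAST v. 2 \<le> v \<and> (\<exists>v1 v2. v * d3 = v1 * d1 + v2 * d2))"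

text \<open>
  The pair of coefficients \<open>(p, q)\<close> of \<open>t\<close>. For coprime \<open>d1\<close>, \<open>d2\<close> and \<open>t\<close> in \<open>gaps d1 d2\<close>
  it exists and is unique; the bounds \<open>q \<le> d1 - 1\<close> and \<open>p \<le> \<lfloor>d2 - d2/d1\<rfloor>\<close> follow from
  \<open>t > 0\<close> and \<open>p, q \<ge> 1\<close>. The equation is over the integers to avoid truncated subtraction.
\<close>

definition gap_coeffs :: "nat \<Rightarrow> nat \<Rightarrow> nat \<Rightarrow> nat \<times> nat" where
  "gap_coeffs d1 d2 t =
     (THE (p, q). 1 \<le> p \<and> 1 \<le> q \<and>
        int t = int d1 * int d2 - int p * int d1 - int q * int d2)"

definition gap_p :: "nat \<Rightarrow> nat \<Rightarrow> nat \<Rightarrow> nat" where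
  "gap_p d1 d2 t = fst (gap_coeffs d1 d2 t)"

definition gap_q :: "nat \<Rightarrow> nat \<Rightarrow> nat \<Rightarrow> nat" where
  "gap_q d1 d2 t = snd (gap_coeffs d1 d2 t)"

text \<open>As \<open>p, q \<ge> 1\<close>, the ranges \<open>u1 \<le> p - 1\<close> and \<open>u2 \<le> q - 1\<close> are \<open>u1 < p\<close> and \<open>u2 < q\<close>.\<close>

definition Omega :: "nat \<Rightarrow> nat \<Rightarrow> nat \<Rightarrow> nat \<Rightarrow> nat set" where
  "Omega d1 d2 d3 k =
     {u1 * d1 + u2 * d2 + k * d3 | u1 u2.
        u1 < gap_p d1 d2 (k * d3) \<and> u2 < gap_q d1 d2 (k * d3)}"

end

theory Submission
  imports Defs
begin

text \<open>
  Represent \<open>\<sigma> = u1 d1 + u2 d2 + k d3\<close> with \<open>k\<close> as small as possible. Then \<open>k < a33\<close>, since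
  otherwise \<open>a33\<close> copies of \<open>d3\<close> could be traded for copies of \<open>d1\<close> and \<open>d2\<close>; and \<open>k d3\<close> is a gap
  because \<open>\<sigma>\<close> is one, so \<open>k d3 = d1 d2 - p d1 - q d2\<close>. If \<open>u1 \<ge> p\<close>, then
  \<open>\<sigma> = (u1 - p) d1 + (d1 - q + u2) d2\<close> would not be a gap; symmetrically for \<open>u2 \<ge> q\<close>.
\<close>

text \<open>Lets a coefficient be a difference such as \<open>int d1 - int q + int u2\<close>, with
  only its sign left to check, so that no truncated subtraction occurs.\<close>

lemma in_semigroup2_int_iff:
  "t \<in> semigroup2 a b \<longleftrightarrow> (\<exists>x y. 0 \<le> x \<and> 0 \<le> y \<and> int t = x * int a + y * int b)"
proof
  assume "t \<in> semigroup2 a b"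
  then obtain u v where "t = u * a + v * b"
    by (auto simp: semigroup2_def)
  then have "int t = int u * int a + int v * int b"
    by simp
  then show "\<exists>x y. 0 \<le> x \<and> 0 \<le> y \<and> int t = x * int a + y * int b"
    by (meson of_nat_0_le_iff)
next
  assume "\<exists>x y. 0 \<le> x \<and> 0 \<le> y \<and> int t = x * int a + y * int b"
  then obtain x y where "0 \<le> x" "0 \<le> y" "int t = x * int a + y * int b"
    by blast
  then have "int t = int (nat x * a + nat y * b)"
    by simp
  then have "t = nat x * a + nat y * b"
    by (simp only: of_nat_eq_iff)
  then show "t \<in> semigroup2 a b"
    by (auto simp: semigroup2_def)
qed

text \<open>Choose \<open>y\<close> in [0, a) with t + y b divisible by a, so that t = z a - y b.
  Since \<open>t\<close> is a gap, y = 0 and z \<ge> b are both impossible, and p = b - z, q = y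
  work.\<close>

lemma gap_representation:
  assumes "coprime a b" and "0 < a" and "t \<in> gaps a b"
  obtains p q :: nat where "1 \<le> p" "1 \<le> q"
    "int t = int a * int b - int p * int a - int q * int b"
proof -
  have notin: "t \<notin> semigroup2 a b"
    using assms(3) by (simp add: gaps_def)
  obtain u v where uv: "u * int a + v * int b = 1"
    using bezout_int[of "int a" "int b"] assms(1)
    by (auto simp: coprime_iff_gcd_eq_1)
  \<comment> \<open>By the Bezout identity \<open>v\<close> inverts \<open>b\<close> modulo
    \<open>a\<close>, so \<open>y\<close> is the residue of -t/b.\<close>
  define y where "y = (- (int t * v)) mod int a"
  have y: "0 \<le> y" "y < int a"
    using assms(2) by (simp_all add: y_def)
  have "int t + (- (int t * v)) * int b = int t * u * int a"
    using arg_cong[OF uv, of "\<lambda>x. int t * x"] by (simp add: algebra_simps)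
  moreover have "(int t + y * int b) mod int a = (int t + (- (int t * v)) * int b) mod int a"
    unfolding y_def by (intro mod_add_cong mod_mult_cong) simp_all
  ultimately have "int a dvd int t + y * int b"
    by (simp add: dvd_eq_mod_eq_0)
  then obtain z where z: "int t + y * int b = int a * z"
    by blast
  have "y \<noteq> 0"
  proof
    assume "y = 0"
    then have eq: "int t = z * int a + 0 * int b"
      using z by (simp add: mult.commute)
    moreover have "0 \<le> z"
    proof -
      have "0 \<le> z * int a"
        using eq by linarith
      then show ?thesis
        using assms(2) by (simp add: zero_le_mult_iff)
    qed
    ultimately show False
      using notin in_semigroup2_int_iff by blast
  qed
  have "z < int b"
  proof (rule ccontr)
    assume "\<not> z < int b"
    \<comment> \<open>Adding and subtracting a b makes both coefficients nonnegative.\<close>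
    moreover have "int t = (z - int b) * int a + (int a - y) * int b"
      using z by (simp add: algebra_simps)
    moreover have "0 \<le> z - int b" "0 \<le> int a - y"
      using y(2) \<open>\<not> z < int b\<close> by simp_all
    ultimately show False
      using notin in_semigroup2_int_iff by blast
  qed
  show thesis
  proof
    show "1 \<le> nat (int b - z)" "1 \<le> nat y"
      using \<open>z < int b\<close> \<open>y \<noteq> 0\<close> y(1) by auto
    show "int t = int a * int b - int (nat (int b - z)) * int a - int (nat y) * int b"
      using z \<open>z < int b\<close> y(1) by (simp add: algebra_simps)
  qed
qed

text \<open>As t \<ge> 0, the positive terms p a and q b sum to at most a b, so each is strictly
  smaller than a b.\<close>

lemma representation_coeff_less:
  fixes p q :: nat
  assumes "0 < a" and "1 \<le> p" "1 \<le> q" and "int t = int a * int b - int p * int a - int q * int b"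
  shows "p < b" "q < a"
proof -
  have eq: "t + p * a + q * b = a * b"
  proof -
    have "int (t + p * a + q * b) = int (a * b)"
      using assms(4) by simp
    then show ?thesis
      by (simp only: of_nat_eq_iff)
  qed
  have "0 < b"
    using eq assms(1,2) by (cases b) auto
  then have "0 < p * a" "0 < q * b"
    using assms(1-3) by simp_all
  then have "p * a < b * a" "q * b < a * b"
    using eq mult.commute[of b a] by linarith+
  then show "p < b" "q < a"
    by simp_all
qed

text \<open>Evaluates the definite description. Two representations satisfy (q - q') b = a (p' - p),
  so by coprimality \<open>a\<close> divides q - q'; as q and q' both lie strictly between 0 and a,
  they are equal, and then so are p and p'.\<close>

lemma gap_coeffs_eq:
  fixes p q :: nat
  assumes "coprime a b" and "0 < a" and "1 \<le> p" "1 \<le> q"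
    and t: "int t = int a * int b - int p * int a - int q * int b"
  shows "gap_coeffs a b t = (p, q)"
  unfolding gap_coeffs_def
proof (rule the_equality)
  show "case (p, q) of (p, q) \<Rightarrow> 1 \<le> p \<and> 1 \<le> q \<and>
      int t = int a * int b - int p * int a - int q * int b"
    using assms by simp
next
  fix r :: "nat \<times> nat"
  assume r: "case r of (p, q) \<Rightarrow> 1 \<le> p \<and> 1 \<le> q \<and>
      int t = int a * int b - int p * int a - int q * int b"
  obtain p' q' where [simp]: "r = (p', q')" by fastforce
  from r have r': "1 \<le> p'" "1 \<le> q'" "int t = int a * int b - int p' * int a - int q' * int b"
    by simp_all
  note less = representation_coeff_less[OF assms(2-4) t] representation_coeff_less[OF assms(2) r']
  have eq: "(int q - int q') * int b = int a * (int p' - int p)"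
    using t r'(3) by (simp add: algebra_simps)
  then have "int a dvd (int q - int q') * int b"
    by simp
  then have "int a dvd int q - int q'"
    using assms(1) by (simp add: coprime_dvd_mult_left_iff)
  then have "q = q'"
    using less dvd_imp_le_int[of "int q - int q'" "int a"] by fastforce
  then show "r = (p, q)"
    using eq less by simp
qed

text \<open>\<open>LEAST\<close> yields a usable value only if some candidate exists; here d1 copies
  of d3 equal d3 copies of d1.\<close>

lemma a33_attained:
  assumes "1 < d1"
  obtains v1 v2 where "2 \<le> a33 d1 d2 d3" "a33 d1 d2 d3 * d3 = v1 * d1 + v2 * d2"
proof -
  have "d1 * d3 = d3 * d1 + 0 * d2"
    by simp
  then have "2 \<le> d1 \<and> (\<exists>v1 v2. d1 * d3 = v1 * d1 + v2 * d2)"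
    using assms by (metis Suc_1 Suc_leI)
  from LeastI[where P = "\<lambda>v. 2 \<le> v \<and> (\<exists>v1 v2. v * d3 = v1 * d1 + v2 * d2)", OF this]
  show thesis
    using that unfolding a33_def by blast
qed

lemma semigroup3_reduced:
  assumes "1 < d1" and "s \<in> semigroup3 d1 d2 d3"
  obtains u1 u2 k where "s = u1 * d1 + u2 * d2 + k * d3" "k < a33 d1 d2 d3"
proof -
  define P where "P = (\<lambda>k. \<exists>u1 u2. s = u1 * d1 + u2 * d2 + k * d3)"
  have ex: "\<exists>k. P k"
    using assms(2) by (auto simp: semigroup3_def P_def)
  define k where "k = (LEAST k. P k)"
  have "P k"
    unfolding k_def using ex by (rule LeastI_ex)
  then obtain u1 u2 where u: "s = u1 * d1 + u2 * d2 + k * d3"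
    by (auto simp: P_def)
  obtain v1 v2 where v: "2 \<le> a33 d1 d2 d3" "a33 d1 d2 d3 * d3 = v1 * d1 + v2 * d2"
    using a33_attained[OF assms(1)] by blast
  have "k < a33 d1 d2 d3"
  proof (rule ccontr)
    assume "\<not> k < a33 d1 d2 d3"
    then obtain m where m: "k = a33 d1 d2 d3 + m"
      by (metis le_add_diff_inverse linorder_not_less)
    have "s = (u1 + v1) * d1 + (u2 + v2) * d2 + m * d3"
      using u v(2) by (simp add: m algebra_simps)
    then have "P m"
      by (auto simp: P_def)
    \<comment> \<open>Contradicts k = a33 + m, because a33 is positive.\<close>
    then have "k \<le> m"
      unfolding k_def by (rule Least_le)
    with m v(1) show False by simp
  qed
  with u show thesis by (rule that)
qed

theorem theorem1:
  fixes d1 d2 d3 \<sigma> :: nat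
  assumes "1 < d1" and "d1 < d2" and "d2 < d3"
    and "coprime d1 d2"
    and "minimal_generators d1 d2 d3"
    and "\<sigma> \<in> gaps d1 d2"
    and "\<sigma> \<in> semigroup3 d1 d2 d3"
  shows "\<exists>k. 1 \<le> k \<and> k < a33 d1 d2 d3 \<and> \<sigma> \<in> Omega d1 d2 d3 k"
proof -
  obtain u1 u2 k where u: "\<sigma> = u1 * d1 + u2 * d2 + k * d3" and k: "k < a33 d1 d2 d3"
    using semigroup3_reduced[OF assms(1,7)] by blast
  have notin: "\<sigma> \<notin> semigroup2 d1 d2"
    using assms(6) by (simp add: gaps_def)
  then have "k \<noteq> 0"
    using u by (cases k) (auto simp: semigroup2_def)
  have "k * d3 \<notin> semigroup2 d1 d2"
  proof
    assume "k * d3 \<in> semigroup2 d1 d2"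
    then obtain w1 w2 where "k * d3 = w1 * d1 + w2 * d2"
      by (auto simp: semigroup2_def)
    then have "\<sigma> = (u1 + w1) * d1 + (u2 + w2) * d2"
      by (simp add: u algebra_simps)
    with notin show False
      by (auto simp: semigroup2_def)
  qed
  then have gap: "k * d3 \<in> gaps d1 d2"
    using \<open>k \<noteq> 0\<close> assms(3) by (simp add: gaps_def)
  have d1: "0 < d1"
    using assms(1) by simp
  obtain p q where pq: "1 \<le> p" "1 \<le> q"
    "int (k * d3) = int d1 * int d2 - int p * int d1 - int q * int d2"
    using gap_representation[OF assms(4) d1 gap] .
  note less = representation_coeff_less[OF d1 pq]
  have gap_pq: "gap_p d1 d2 (k * d3) = p" "gap_q d1 d2 (k * d3) = q"
    using gap_coeffs_eq[OF assms(4) d1 pq] by (simp_all add: gap_p_def gap_q_def)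
  have \<sigma>: "int \<sigma> = int u1 * int d1 + int u2 * int d2 + int (k * d3)"
    by (simp add: u)
  have "u1 < p"
  proof (rule ccontr)
    assume "\<not> u1 < p"
    then have "0 \<le> int u1 - int p" "0 \<le> int d1 - int q + int u2"
      using less by simp_all
    \<comment> \<open>The product d1 d2 in the representation of k d3 is read as d1 copies of d2,
      which absorb -q.\<close>
    moreover have "int \<sigma> = (int u1 - int p) * int d1 + (int d1 - int q + int u2) * int d2"
      using \<sigma> pq(3) by (simp add: algebra_simps)
    ultimately show False
      using notin in_semigroup2_int_iff by blast
  qed
  moreover have "u2 < q"
  proof (rule ccontr)
    assume "\<not> u2 < q"
    then have "0 \<le> int d2 - int p + int u1" "0 \<le> int u2 - int q"
      using less by simp_all
    \<comment> \<open>Now d1 d2 is read as d2 copies of d1, which absorb -p.\<close>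
    moreover have "int \<sigma> = (int d2 - int p + int u1) * int d1 + (int u2 - int q) * int d2"
      using \<sigma> pq(3) by (simp add: algebra_simps)
    ultimately show False
      using notin in_semigroup2_int_iff by blast
  qed
  ultimately have "\<sigma> \<in> Omega d1 d2 d3 k"
    using u by (auto simp: Omega_def gap_pq)
  with k \<open>k \<noteq> 0\<close> show ?thesis
    by (intro exI[of _ k]) simp
qed

end
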